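(* $\mathrm{Aut}(KNO_{1[(3,4^4)]})=\langle\alpha_1,\alpha_2\rangle\cong\mathbb{Z}_2\times\mathbb{Z}_2$, $\mathrm{Aut}(KNO_{2[(3,4^4)]})=\langle\beta_1,\beta_2,\beta_3,\beta_4\rangle\cong S_4$, and $\mathrm{Aut}(KO_{[(3,4^4)]})=\langle\gamma\rangle\cong\mathbb{Z}_{12}$, where $\alpha_1=(1,6)(2,5)(3,4)(7,9)(10,11)$, $\alpha_2=(0,8)(1,7)(2,3)(4,5)(6,9)(10,11)$, $\beta_1=(1,6)(2,5)(3,4)(7,9)(10,11)$, $\beta_2=(0,6,1)(2,8,5)(3,7,10)(4,11,9)$, $\beta_3=(0,8)(1,7)(2,4)(3,5)(6,9)(10,11)$, $\beta_4=(0,10)(1,4)(2,7)(3,9)(5,6)(8,11)$ and $\gamma=(0,2,9,10,4,6,1,8,3,11,5,7)$.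
   Context: A map is a finite (combinatorial) polyhedral 2-complex whose geometric carrier is a compact connected 2-manifold without boundary; its 2-faces are polygons identified with cycles of distinct vertices. An automorphism of a map is a permutation of its vertex set carrying faces (as cycles) onto faces; $\mathrm{Aut}(X)$ is the group of all automorphisms of $X$ under composition. Permutations are written in disjoint cycle notation, omitted vertices being fixed. $S_4$ is the symmetric group on four letters. The following maps have vertex set $\{0,1,\dots,11\}$; $[a,b,c]$ is a triangle and $[a,b,c,d]$ is the quadrilateral with boundary cycle $a\,b\,c\,d\,a$. $KNO_{1[(3,4^4)]}$ has faces: $[0,3,4]$, $[1,9,10]$, $[6,7,11]$, $[2,5,8]$, $[0,1,2,3]$, $[0,4,5,6]$, $[0,6,7,8]$, $[0,1,9,8]$, $[6,1,10,5]$, $[1,6,11,2]$, $[8,5,4,9]$, $[8,2,3,7]$, $[7,9,10,3]$, $[9,7,11,4]$, $[2,5,10,11]$, $[4,3,10,11]$. $KNO_{2[(3,4^4)]}$ has faces: $[0,3,4]$, $[6,7,11]$, $[1,9,10]$, $[2,5,8]$, $[0,1,2,3]$, $[0,4,5,6]$, $[0,6,7,8]$, $[0,1,9,8]$, $[1,6,11,2]$, $[6,1,10,5]$, $[3,4,10,11]$, $[11,10,5,2]$, $[3,2,8,9]$, $[3,9,7,11]$, $[4,5,8,7]$, $[4,7,9,10]$. $KO_{[(3,4^4)]}$ has faces: $[0,3,4]$, $[2,6,11]$, $[1,5,9]$, $[7,8,10]$, $[0,1,2,3]$, $[0,4,5,6]$, $[0,6,7,8]$, $[0,1,9,8]$,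 $[1,7,6,2]$, $[6,11,10,5]$, $[3,4,11,9]$, $[9,11,2,8]$, $[3,2,8,10]$, $[3,10,5,9]$, $[4,5,1,7]$, $[4,7,10,11]$. *)

theory Defs
  imports "HOL-Algebra.Sym_Groups" "HOL-Algebra.Elementary_Groups"
begin

text \<open>
  A polygon with boundary cycle \<open>c\<^sub>0 c\<^sub>1 \<dots> c\<^sub>k c\<^sub>0\<close> is the cycle itself: the list of its
  vertices up to the choice of a starting point and of a direction.
\<close>

definition polygon :: "'v list \<Rightarrow> 'v list set" where
  "polygon cs = range (\<lambda>n. rotate n cs) \<union> range (\<lambda>n. rotate n (rev cs))"

text \<open>
  A map is given by its vertex set and its 2-faces. That the carrier is a closed connected
  surface plays no role in the definition of an automorphism and is not recorded here.
\<close>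

record 'v surface_map =
  verts :: "'v set"
  faces :: "'v list set set"

definition perm_group :: "'v set \<Rightarrow> ('v \<Rightarrow> 'v) monoid" where
  "perm_group V = \<lparr>carrier = {p. p permutes V}, mult = (\<circ>), one = id\<rparr>"

definition Aut :: "'v surface_map \<Rightarrow> ('v \<Rightarrow> 'v) monoid" where
  "Aut X = (perm_group (verts X))
     \<lparr>carrier := {p. p permutes verts X \<and> (\<lambda>F. map p ` F) ` faces X = faces X}\<rparr>"

lemma image_polygon: "map p ` polygon cs = polygon (map p cs)"
  by (simp add: polygon_def image_Un image_image rotate_map rev_map)

lemma group_perm_group: "group (perm_group V)"
proof (rule groupI)
  fix p assume "p \<in> carrier (perm_group V)"
  then have "p permutes V" by (simp add: perm_group_def)
  then show "\<exists>q\<in>carrier (perm_group V). q \<otimes>\<^bsub>perm_group V\<^esub> p = \<one>\<^bsub>perm_group V\<^esub>"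
    by (intro bexI[of _ "inv' p"]) (simp_all add: perm_group_def permutes_inv permutes_inv_o)
qed (auto simp: perm_group_def permutes_compose permutes_id comp_assoc)

lemma group_Aut: "group (Aut X)"
proof (rule groupI)
  fix p q assume "p \<in> carrier (Aut X)" "q \<in> carrier (Aut X)"
  then have pq: "p permutes verts X" "q permutes verts X"
    and p: "(\<lambda>F. map p ` F) ` faces X = faces X" and q: "(\<lambda>F. map q ` F) ` faces X = faces X"
    by (simp_all add: Aut_def)
  have "(\<lambda>F. map (p \<circ> q) ` F) ` faces X = (\<lambda>F. map p ` F) ` (\<lambda>F. map q ` F) ` faces X"
    by (simp add: image_image)
  then show "p \<otimes>\<^bsub>Aut X\<^esub> q \<in> carrier (Aut X)"
    using pq p q by (simp add: Aut_def perm_group_def permutes_compose)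
next
  fix p assume "p \<in> carrier (Aut X)"
  then have p: "p permutes verts X" and F: "(\<lambda>F. map p ` F) ` faces X = faces X"
    by (simp_all add: Aut_def)
  have "(\<lambda>F. map (inv' p) ` F) ` faces X = (\<lambda>F. map (inv' p) ` F) ` (\<lambda>F. map p ` F) ` faces X"
    by (simp add: F)
  also have "\<dots> = faces X"
    by (simp add: image_image permutes_inv_o[OF p])
  finally show "\<exists>q\<in>carrier (Aut X). q \<otimes>\<^bsub>Aut X\<^esub> p = \<one>\<^bsub>Aut X\<^esub>"
    using p by (intro bexI[of _ "inv' p"])
      (simp_all add: Aut_def perm_group_def permutes_inv permutes_inv_o)
qed (auto simp: Aut_def perm_group_def permutes_id comp_assoc)

definition perm_of_cycles :: "'v list list \<Rightarrow> 'v \<Rightarrow> 'v" where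
  "perm_of_cycles css = foldr (\<lambda>cs p. cycle_of_list cs \<circ> p) css id"

definition KNO1 :: "nat surface_map" where
  "KNO1 = \<lparr>verts = {0..11}, faces = polygon `
     {[0,3,4], [1,9,10], [6,7,11], [2,5,8],
      [0,1,2,3], [0,4,5,6], [0,6,7,8], [0,1,9,8],
      [6,1,10,5], [1,6,11,2], [8,5,4,9], [8,2,3,7],
      [7,9,10,3], [9,7,11,4], [2,5,10,11], [4,3,10,11]}\<rparr>"

definition KNO2 :: "nat surface_map" where
  "KNO2 = \<lparr>verts = {0..11}, faces = polygon `
     {[0,3,4], [6,7,11], [1,9,10], [2,5,8],
      [0,1,2,3], [0,4,5,6], [0,6,7,8], [0,1,9,8],
      [1,6,11,2], [6,1,10,5], [3,4,10,11], [11,10,5,2],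
      [3,2,8,9], [3,9,7,11], [4,5,8,7], [4,7,9,10]}\<rparr>"

definition KO :: "nat surface_map" where
  "KO = \<lparr>verts = {0..11}, faces = polygon `
     {[0,3,4], [2,6,11], [1,5,9], [7,8,10],
      [0,1,2,3], [0,4,5,6], [0,6,7,8], [0,1,9,8],
      [1,7,6,2], [6,11,10,5], [3,4,11,9], [9,11,2,8],
      [3,2,8,10], [3,10,5,9], [4,5,1,7], [4,7,10,11]}\<rparr>"

definition \<alpha>\<^sub>1 :: "nat \<Rightarrow> nat" where
  "\<alpha>\<^sub>1 = perm_of_cycles [[1,6], [2,5], [3,4], [7,9], [10,11]]"

definition \<alpha>\<^sub>2 :: "nat \<Rightarrow> nat" where
  "\<alpha>\<^sub>2 = perm_of_cycles [[0,8], [1,7], [2,3], [4,5], [6,9], [10,11]]"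

definition \<beta>\<^sub>1 :: "nat \<Rightarrow> nat" where
  "\<beta>\<^sub>1 = perm_of_cycles [[1,6], [2,5], [3,4], [7,9], [10,11]]"

definition \<beta>\<^sub>2 :: "nat \<Rightarrow> nat" where
  "\<beta>\<^sub>2 = perm_of_cycles [[0,6,1], [2,8,5], [3,7,10], [4,11,9]]"

definition \<beta>\<^sub>3 :: "nat \<Rightarrow> nat" where
  "\<beta>\<^sub>3 = perm_of_cycles [[0,8], [1,7], [2,4], [3,5], [6,9], [10,11]]"

definition \<beta>\<^sub>4 :: "nat \<Rightarrow> nat" where
  "\<beta>\<^sub>4 = perm_of_cycles [[0,10], [1,4], [2,7], [3,9], [5,6], [8,11]]"

definition \<gamma> :: "nat \<Rightarrow> nat" where
  "\<gamma> = perm_of_cycles [[0,2,9,10,4,6,1,8,3,11,5,7]]"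

end

theory Submission
  imports Defs "HOL-Algebra.Multiplicative_Group"
begin

text \<open>
  In each of the three maps the vertex 0 lies on the triangle 0 3 4 and on four quadrilaterals,
  and the faces at 0 cover all vertices but 10 and 11. An automorphism is therefore known once the
  images of 0, 3, 4 are: the triangle 0 3 4 goes to one of the four triangles, read from one of
  its corners in one of two directions, which leaves 24 possibilities. Across the edge 0 3 of the
  image triangle there is only one further face, it must be the image of the quadrilateral
  0 1 2 3, and so the star of 0 unfolds from face to face. The other faces determine the
  images of the two remaining vertices, and they reject those of the 24 candidates that do not
  extend to the whole map: 4, 24 and 12 of them survive in the three maps.

  This argument is run as a backtracking search for the maps of vertices that send faces to
  faces. The search is proved complete for arbitrary lists of faces (\<open>search_complete\<close>), and for the
  three maps its result is computed by rewriting. Every surviving candidate is a product of powers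
  of the stated generators, taken in a fixed order, and the generators preserve the faces; hence
  the automorphism group is the group they generate, and its order is the number of products
  (\<open>Aut_by_search\<close>).

  The isomorphism types then follow from little more than the orders. A cyclic group of order 12
  is \<open>\<int>\<^bsub>12\<^esub>\<close>; a group of order 4 with two different involutions is the Klein four-group. The four
  triangles of \<open>KNO\<^sub>2\<close> partition its vertices, so its automorphisms permute the triangles; this
  action is faithful, and since the group has order \<open>24 = 4!\<close>, every permutation of the triangles
  occurs.
\<close>

section \<open>Polygons and automorphisms\<close>

lemma range_rotate_rotate: "range (\<lambda>n. rotate n (rotate k cs)) = range (\<lambda>n. rotate n cs)"
proof (cases "cs = []")
  case False
  have "rotate n cs = rotate (n + (k * length cs - k)) (rotate k cs)" for n
  proof -
    have "k \<le> k * length cs" using False by (cases "length cs") auto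
    then have "n + (k * length cs - k) + k = n + k * length cs" by linarith
    then have "rotate (n + (k * length cs - k)) (rotate k cs) = rotate (n + k * length cs) cs"
      by (simp only: rotate_rotate)
    also have "\<dots> = rotate n cs" by (metis mod_mult_self1 rotate_conv_mod)
    finally show ?thesis by simp
  qed
  then show ?thesis by (auto simp: rotate_rotate)
qed simp

lemma rev_rotate: "\<exists>j. rev (rotate k cs) = rotate j (rev cs)"
proof
  let ?l = "length cs" and ?j = "length cs - k mod length cs"
  have "rotate ?j (rev cs) = rev (rotate (?l - ?j mod ?l) cs)"
    by (simp add: rotate_rev)
  also have "\<dots> = rev (rotate k cs)"
  proof (cases "cs = [] \<or> k mod ?l = 0")
    case True
    then have "rotate k cs = cs" using rotate_conv_mod[of k cs] by auto
    then show ?thesis using True by auto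
  next
    case False
    then have "?l - ?j mod ?l = k mod ?l" by simp
    then show ?thesis using rotate_conv_mod[of k cs] by simp
  qed
  finally show "rev (rotate k cs) = rotate ?j (rev cs)" by simp
qed

lemma polygon_rotate: "polygon (rotate k cs) = polygon cs"
proof -
  obtain j where "rev (rotate k cs) = rotate j (rev cs)" using rev_rotate by blast
  then show ?thesis by (simp add: polygon_def range_rotate_rotate)
qed

lemma polygon_rev: "polygon (rev cs) = polygon cs"
  by (simp add: polygon_def Un_commute)

text \<open>
  Polygons are the classes of an equivalence relation on lists, so that a face is determined by
  any of the lists that trace its boundary.
\<close>

lemma polygon_eqI:
  assumes "w \<in> polygon cs"
  shows "polygon w = polygon cs"
proof -
  obtain k where "w = rotate k cs \<or> w = rotate k (rev cs)"
    using assms by (auto simp: polygon_def)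
  then show ?thesis by (auto simp: polygon_rotate polygon_rev)
qed

lemma self_in_polygon: "cs \<in> polygon cs"
  unfolding polygon_def by (metis UnI1 rangeI rotate0 id_apply)

definition boundary_words :: "'v list list \<Rightarrow> 'v list list" where
  "boundary_words fs = concat (map (\<lambda>f.
     map (\<lambda>k. rotate k f) [0..<length f] @ map (\<lambda>k. rotate k (rev f)) [0..<length f]) fs)"

lemma polygon_finite_range:
  assumes "cs \<noteq> []"
  shows "polygon cs = (\<lambda>k. rotate k cs) ` {0..<length cs} \<union> (\<lambda>k. rotate k (rev cs)) ` {0..<length cs}"
proof -
  have "range (\<lambda>k. rotate k xs) = (\<lambda>k. rotate k xs) ` {0..<length xs}" if "xs \<noteq> []" for xs :: "'a list"
  proof -
    have "rotate k xs \<in> (\<lambda>k. rotate k xs) ` {0..<length xs}" for k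
      using that by (subst rotate_conv_mod) (auto intro!: imageI)
    then show ?thesis by auto
  qed
  from this[of cs] this[of "rev cs"] assms show ?thesis
    unfolding polygon_def by (simp only: length_rev rev_is_Nil_conv not_False_eq_True)
qed

lemma set_boundary_words:
  "[] \<notin> set fs \<Longrightarrow> set (boundary_words fs) = \<Union> (polygon ` set fs)"
proof (induction fs)
  case (Cons f fs)
  have "set (boundary_words (f # fs)) = polygon f \<union> set (boundary_words fs)"
    using Cons.prems by (auto simp: boundary_words_def polygon_finite_range[of f])
  then show ?case using Cons by simp
qed (simp add: boundary_words_def)

text \<open>
  A permutation induces an injection on polygons, and there are only finitely many faces; hence
  it suffices that each face is sent to a face, and this can be tested on one list per face.
\<close>

lemma carrier_Aut_iff:
  assumes F: "faces X = polygon ` set fs" and ne: "[] \<notin> set fs"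
  shows "p \<in> carrier (Aut X) \<longleftrightarrow>
    p permutes verts X \<and> (\<forall>f\<in>set fs. map p f \<in> set (boundary_words fs))"
proof (intro iffI conjI ballI)
  fix f assume "p \<in> carrier (Aut X)" "f \<in> set fs"
  then have "map p ` polygon f \<in> polygon ` set fs" by (auto simp: Aut_def F image_image)
  moreover have "map p f \<in> map p ` polygon f" by (intro imageI self_in_polygon)
  ultimately have "map p f \<in> \<Union> (polygon ` set fs)" by (rule UnionI)
  then show "map p f \<in> set (boundary_words fs)" by (simp add: set_boundary_words[OF ne])
next
  assume A: "p permutes verts X \<and> (\<forall>f\<in>set fs. map p f \<in> set (boundary_words fs))"
  then have "inj (map p)" by (auto intro: inj_mapI permutes_inj)
  then have inj: "inj_on (\<lambda>F. map p ` F) (faces X)"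
    by (simp add: inj_on_def inj_image_eq_iff)
  have "map p ` polygon f \<in> polygon ` set fs" if "f \<in> set fs" for f
  proof -
    from A that obtain g where "g \<in> set fs" "map p f \<in> polygon g"
      by (auto simp: set_boundary_words[OF ne])
    then show ?thesis by (auto simp: image_polygon dest: polygon_eqI)
  qed
  then have "(\<lambda>F. map p ` F) ` faces X \<subseteq> faces X" by (auto simp: F)
  then have "(\<lambda>F. map p ` F) ` faces X = faces X"
    using inj by (intro endo_inj_surj) (simp_all add: F)
  with A show "p \<in> carrier (Aut X)" by (simp add: Aut_def)
qed (simp add: Aut_def)

section \<open>Searching for face-preserving maps of vertices\<close>

text \<open>
  Entry \<open>v\<close> lists the boundary words that start at the vertex \<open>v\<close>. When the image of the first
  vertex of a face is known, only the words of one entry, two for each face at that vertex, can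
  be the image of the face.
\<close>

primrec corner_table :: "nat \<Rightarrow> nat list list \<Rightarrow> nat list list list" where
  "corner_table n [] = replicate n []"
| "corner_table n (w # ws) = (let T = corner_table n ws in T[hd w := w # T ! hd w])"

lemma length_corner_table [simp]: "length (corner_table n ws) = n"
  by (induction ws) (simp_all add: Let_def)

lemma set_corner_table:
  "v < n \<Longrightarrow> set (corner_table n ws ! v) = {w \<in> set ws. hd w = v}"
proof (induction ws)
  case (Cons w ws)
  then show ?case
    by (cases "hd w = v") (auto simp: Let_def)
qed simp

text \<open>
  A list \<open>\<sigma>\<close> of optional vertices is a partial map: entry \<open>x\<close> is the image of the vertex \<open>x\<close>, as
  far as it has been decided. The functions below extend partial maps so that a given face is
  sent to one of the candidate words. They are written by recursion on the lists of words and of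
  partial maps, and not with \<open>map\<close> and an abstraction, because rewriting would unfold the search
  inside the abstraction, where the partial map is still a variable.
\<close>

fun extend :: "nat option list \<Rightarrow> nat list \<Rightarrow> nat list \<Rightarrow> nat option list list" where
  "extend \<sigma> [] [] = [\<sigma>]"
| "extend \<sigma> (x # xs) (y # ys) =
     (case \<sigma> ! x of
        None \<Rightarrow> extend (\<sigma>[x := Some y]) xs ys
      | Some z \<Rightarrow> if z = y then extend \<sigma> xs ys else [])"
| "extend \<sigma> _ _ = []"

primrec extensions :: "nat option list \<Rightarrow> nat list \<Rightarrow> nat list list \<Rightarrow> nat option list list" where
  "extensions \<sigma> f [] = []"
| "extensions \<sigma> f (w # ws) = extend \<sigma> f w @ extensions \<sigma> f ws"

definition candidates :: "nat list list list \<Rightarrow> nat option list \<Rightarrow> nat list \<Rightarrow> nat list list" where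
  "candidates T \<sigma> f = (case \<sigma> ! hd f of None \<Rightarrow> concat T | Some v \<Rightarrow> T ! v)"

primrec extend_all :: "nat list list list \<Rightarrow> nat list \<Rightarrow> nat option list list \<Rightarrow> nat option list list"
  where
  "extend_all T f [] = []"
| "extend_all T f (\<sigma> # \<sigma>s) = extensions \<sigma> f (candidates T \<sigma> f) @ extend_all T f \<sigma>s"

primrec search :: "nat list list list \<Rightarrow> nat list list \<Rightarrow> nat option list list \<Rightarrow> nat option list list"
  where
  "search T [] \<sigma>s = \<sigma>s"
| "search T (f # fs) \<sigma>s = search T fs (extend_all T f \<sigma>s)"

definition agrees :: "(nat \<Rightarrow> nat) \<Rightarrow> nat option list \<Rightarrow> bool" where
  "agrees p \<sigma> \<longleftrightarrow> (\<forall>i<length \<sigma>. \<sigma> ! i = None \<or> \<sigma> ! i = Some (p i))"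

lemma extend_complete:
  assumes "agrees p \<sigma>" "set f \<subseteq> {..<length \<sigma>}"
  shows "\<exists>\<tau>\<in>set (extend \<sigma> f (map p f)). agrees p \<tau> \<and> length \<tau> = length \<sigma>"
  using assms
proof (induction f arbitrary: \<sigma>)
  case (Cons x xs)
  show ?case
  proof (cases "\<sigma> ! x")
    case None
    have "agrees p (\<sigma>[x := Some (p x)])"
      using Cons.prems by (auto simp: agrees_def nth_list_update)
    from Cons.IH[OF this] show ?thesis using None Cons.prems by simp
  next
    case (Some z)
    then have "z = p x" using Cons.prems by (auto simp: agrees_def)
    then show ?thesis using Cons.IH[of \<sigma>] Cons.prems Some by simp
  qed
qed auto

lemma set_extensions: "set (extensions \<sigma> f ws) = (\<Union>w\<in>set ws. set (extend \<sigma> f w))"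
  by (induction ws) auto

lemma set_extend_all:
  "set (extend_all T f \<sigma>s) = (\<Union>\<sigma>\<in>set \<sigma>s. set (extensions \<sigma> f (candidates T \<sigma> f)))"
  by (induction \<sigma>s) auto

text \<open>
  The search keeps every partial map that agrees with \<open>p\<close>: when a face is treated, the word that
  \<open>p\<close> traces along its image is among the candidates, and following it keeps the agreement.
\<close>

lemma search_complete:
  assumes "\<sigma> \<in> set \<sigma>s" "agrees p \<sigma>" "length \<sigma> = n"
    and "\<And>f. f \<in> set fs \<Longrightarrow> f \<noteq> [] \<and> set f \<subseteq> {..<n}"
    and "\<And>f. f \<in> set fs \<Longrightarrow> p (hd f) < length T \<and> map p f \<in> set (T ! p (hd f))"
  shows "\<exists>\<tau>\<in>set (search T fs \<sigma>s). agrees p \<tau> \<and> length \<tau> = n"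
  using assms
proof (induction fs arbitrary: \<sigma> \<sigma>s)
  case (Cons f fs)
  have f: "f \<noteq> []" "set f \<subseteq> {..<n}" "p (hd f) < length T" "map p f \<in> set (T ! p (hd f))"
    using Cons.prems(4,5)[of f] by auto
  then have "hd f < length \<sigma>" using Cons.prems(3) by (cases f) auto
  then have "map p f \<in> set (candidates T \<sigma> f)"
  proof (cases "\<sigma> ! hd f")
    case None
    have "T ! p (hd f) \<in> set T" using f(3) by simp
    then show ?thesis using f(4) None by (auto simp: candidates_def)
  next
    case (Some v)
    then have "v = p (hd f)" using Cons.prems(2) \<open>hd f < length \<sigma>\<close> by (auto simp: agrees_def)
    then show ?thesis using f(4) Some by (simp add: candidates_def)
  qed
  moreover obtain \<tau> where "\<tau> \<in> set (extend \<sigma> f (map p f))" "agrees p \<tau>" "length \<tau> = n"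
    using extend_complete[OF Cons.prems(2), of f] f(2) Cons.prems(3) by auto
  ultimately have "\<tau> \<in> set (extend_all T f \<sigma>s)"
    using Cons.prems(1) by (auto simp: set_extend_all set_extensions)
  from Cons.IH[OF this \<open>agrees p \<tau>\<close> \<open>length \<tau> = n\<close>] Cons.prems(4,5)
  show ?case by simp
qed auto

section \<open>Permutations as rows of images\<close>

definition row :: "nat \<Rightarrow> (nat \<Rightarrow> nat) \<Rightarrow> nat list" where
  "row n p = map p [0..<n]"

definition compose_rows :: "nat list \<Rightarrow> nat list \<Rightarrow> nat list" where
  "compose_rows r s = map ((!) r) s"

primrec power_row :: "nat \<Rightarrow> nat list \<Rightarrow> nat \<Rightarrow> nat list" where
  "power_row n r 0 = [0..<n]"
| "power_row n r (Suc k) = compose_rows r (power_row n r k)"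

text \<open>
  The rows of the products \<open>g\<^sub>1^k\<^sub>1 \<circ> g\<^sub>2^k\<^sub>2 \<circ> \<dots>\<close> with \<open>k\<^sub>i < m\<^sub>i\<close>, for the list of the pairs \<open>(g\<^sub>i, m\<^sub>i)\<close>.
\<close>

primrec product_rows :: "nat \<Rightarrow> (nat list \<times> nat) list \<Rightarrow> nat list list" where
  "product_rows n [] = [[0..<n]]"
| "product_rows n (g # gs) = concat (map (\<lambda>r. map (compose_rows r) (product_rows n gs))
     (map (power_row n (fst g)) [0..<snd g]))"

lemma compose_rows_map: "set f \<subseteq> {..<n} \<Longrightarrow> compose_rows (row n p) f = map p f"
  by (auto simp: compose_rows_def row_def)

lemma inj_on_row: "inj_on (row n) {p. p permutes {..<n}}"
proof (rule inj_onI)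
  fix p q assume *: "p \<in> {p. p permutes {..<n}}" "q \<in> {p. p permutes {..<n}}" "row n p = row n q"
  then have "p i = q i" for i
    by (cases "i < n") (auto simp: row_def permutes_not_in)
  then show "p = q" by blast
qed

lemma perm_group_sel [simp]:
  "carrier (perm_group V) = {p. p permutes V}" "p \<otimes>\<^bsub>perm_group V\<^esub> q = p \<circ> q" "\<one>\<^bsub>perm_group V\<^esub> = id"
  by (simp_all add: perm_group_def)

lemma product_rows_in_generate:
  assumes S: "S \<subseteq> carrier (perm_group {..<n})"
    and gs: "\<forall>g\<in>set gs. fst g \<in> row n ` S"
  shows "set (product_rows n gs) \<subseteq> row n ` generate (perm_group {..<n}) S"
proof -
  interpret group "perm_group {..<n}" by (rule group_perm_group)
  let ?H = "generate (perm_group {..<n}) S"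
  have H: "?H \<subseteq> {p. p permutes {..<n}}" using generate_incl[OF S] by simp
  have comp: "compose_rows r s \<in> row n ` ?H" if "r \<in> row n ` ?H" "s \<in> row n ` ?H" for r s
  proof -
    from that obtain p q where pq: "r = row n p" "p \<in> ?H" "s = row n q" "q \<in> ?H"
      by (elim imageE)
    then have "set s \<subseteq> {..<n}" using H permutes_in_image by (fastforce simp: row_def)
    then have "compose_rows r s = row n (p \<circ> q)"
      using pq by (simp add: compose_rows_map) (simp add: row_def)
    moreover have "p \<circ> q \<in> ?H" using generate.eng[OF pq(2,4)] by simp
    ultimately show ?thesis by blast
  qed
  have one: "[0..<n] \<in> row n ` ?H"
    using generate.one[of "perm_group {..<n}" S] by (force simp: row_def)
  have power: "power_row n r k \<in> row n ` ?H" if "r \<in> row n ` S" for r k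
  proof -
    have "r \<in> row n ` ?H" using that generate.incl[of _ S] by fast
    then show ?thesis by (induction k) (simp_all add: one comp)
  qed
  from gs show ?thesis
  proof (induction gs)
    case (Cons g gs)
    then show ?case by (auto intro!: comp power)
  qed (simp add: one)
qed

lemma subgroup_Aut: "subgroup (carrier (Aut X)) (perm_group (verts X))"
proof (rule group.group_incl_imp_subgroup[OF group_perm_group])
  show "carrier (Aut X) \<subseteq> carrier (perm_group (verts X))" by (auto simp: Aut_def)
  have "perm_group (verts X)\<lparr>carrier := carrier (Aut X)\<rparr> = Aut X" by (simp add: Aut_def)
  then show "group (perm_group (verts X)\<lparr>carrier := carrier (Aut X)\<rparr>)" by (simp add: group_Aut)
qed

section \<open>Automorphism groups from the search\<close>

text \<open>
  The two computed hypotheses squeeze the automorphism group: by \<open>aut\<close> it contains the group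
  generated by \<open>gens\<close>, and by \<open>exhaustive\<close> each automorphism is one of the products of powers of
  generators, so that it lies in that group. The bounds \<open>ks\<close> on the exponents are only a hint
  saying which products to try.
\<close>

lemma Aut_by_search:
  fixes X :: "nat surface_map"
  defines "T \<equiv> \<lambda>n fs. corner_table n (boundary_words fs)"
  assumes X: "verts X = {..<n}" "faces X = polygon ` set fs"
    and fs: "\<forall>f\<in>set fs. f \<noteq> [] \<and> set f \<subseteq> {..<n}"
    and gens: "\<forall>g\<in>set gens. g permutes {..<n}" "map (row n) gens = rows"
    and aut: "\<forall>r\<in>set rows. \<forall>f\<in>set fs. compose_rows r f \<in> set (T n fs ! hd (compose_rows r f))"
    and exhaustive: "set (search (T n fs) fs [replicate n None])
           \<subseteq> set (map (map Some) (product_rows n (zip rows ks)))"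
  shows "carrier (Aut X) = generate (perm_group {..<n}) (set gens)"
    and "row n ` carrier (Aut X) = set (product_rows n (zip rows ks))"
proof -
  interpret group "perm_group {..<n}" by (rule group_perm_group)
  let ?P = "product_rows n (zip rows ks)" and ?H = "generate (perm_group {..<n}) (set gens)"
  have ne: "[] \<notin> set fs" using fs by blast
  note Aut_iff = carrier_Aut_iff[OF X(2) ne, unfolded X(1)]
  have hd_less: "p (hd f) < n" if "p permutes {..<n}" "f \<in> set fs" for p f
  proof -
    have "hd f < n" using fs that(2) by (cases f) auto
    then show ?thesis using permutes_in_image[OF that(1)] by simp
  qed
  have "set gens \<subseteq> carrier (Aut X)"
  proof
    fix g assume g: "g \<in> set gens"
    have "map g f \<in> set (boundary_words fs)" if "f \<in> set fs" for f
    proof -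
      have "f \<noteq> []" "set f \<subseteq> {..<n}" using fs that by auto
      moreover have "row n g \<in> set rows" using g gens(2) by auto
      ultimately have "map g f \<in> set (T n fs ! g (hd f))"
        using aut[rule_format, of "row n g" f] that by (simp add: compose_rows_map hd_map)
      then show ?thesis using hd_less[of g f] gens(1) g that by (simp add: T_def set_corner_table)
    qed
    then show "g \<in> carrier (Aut X)" using gens(1) g by (simp add: Aut_iff)
  qed
  then have HA: "?H \<subseteq> carrier (Aut X)"
    using subgroup_Aut[of X] unfolding X(1) by (rule generate_subgroup_incl)
  have "set rows = row n ` set gens" using gens(2) by auto
  then have "\<forall>g\<in>set (zip rows ks). fst g \<in> row n ` set gens" by (auto dest: set_zip_leftD)
  then have PH: "set ?P \<subseteq> row n ` ?H"
    using gens(1) by (intro product_rows_in_generate) auto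
  have AP: "row n ` carrier (Aut X) \<subseteq> set ?P"
  proof (rule image_subsetI)
    fix p assume "p \<in> carrier (Aut X)"
    then have p: "p permutes {..<n}" "\<forall>f\<in>set fs. map p f \<in> set (boundary_words fs)"
      by (simp_all add: Aut_iff)
    have "\<exists>\<tau>\<in>set (search (T n fs) fs [replicate n None]). agrees p \<tau> \<and> length \<tau> = n"
    proof (rule search_complete)
      show "replicate n None \<in> set [replicate n None]" by simp
      show "f \<noteq> [] \<and> set f \<subseteq> {..<n}" if "f \<in> set fs" for f using fs that by blast
      show "p (hd f) < length (T n fs) \<and> map p f \<in> set (T n fs ! p (hd f))" if "f \<in> set fs" for f
        using hd_less[OF p(1) that] p(2) fs that by (simp add: T_def set_corner_table hd_map)
    qed (simp_all add: agrees_def)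
    then obtain \<tau> where \<tau>: "\<tau> \<in> set (map (map Some) ?P)" "agrees p \<tau>" "length \<tau> = n"
      using exhaustive by blast
    then obtain r where r: "r \<in> set ?P" "agrees p (map Some r)" "length r = n"
      by auto
    then have "row n p = r" by (intro nth_equalityI) (simp_all add: row_def agrees_def)
    then show "row n p \<in> set ?P" using r(1) by simp
  qed
  have "carrier (Aut X) \<subseteq> ?H"
  proof
    fix p assume p: "p \<in> carrier (Aut X)"
    have "p \<in> {p. p permutes {..<n}}" using p by (simp add: Aut_def X(1))
    moreover have "?H \<subseteq> {p. p permutes {..<n}}" using generate_incl[of "set gens"] gens(1) by auto
    moreover have "row n p \<in> row n ` ?H" using AP PH p by blast
    ultimately show "p \<in> ?H" using inj_on_image_mem_iff[OF inj_on_row] by blast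
  qed
  then show "carrier (Aut X) = ?H" using HA by blast
  then show "row n ` carrier (Aut X) = set ?P" using AP PH by blast
qed

lemma order_Aut:
  assumes "verts X = {..<n}" "row n ` carrier (Aut X) = set rs" "distinct rs"
  shows "order (Aut X) = length rs"
proof -
  have "inj_on (row n) (carrier (Aut X))"
    by (rule inj_on_subset[OF inj_on_row]) (auto simp: Aut_def assms(1))
  then have "card (carrier (Aut X)) = card (set rs)"
    using card_image assms(2) by metis
  then show ?thesis using assms(3) by (simp add: order_def distinct_card)
qed

lemma generate_Aut:
  assumes "K \<subseteq> carrier (Aut X)"
  shows "generate (Aut X) K = generate (perm_group (verts X)) K"
proof -
  have "Aut X = perm_group (verts X)\<lparr>carrier := carrier (Aut X)\<rparr>" by (simp add: Aut_def)
  then show ?thesis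
    using group.generate_consistent[OF group_perm_group assms subgroup_Aut] by simp
qed

lemma Aut_sel:
  "p \<otimes>\<^bsub>Aut X\<^esub> q = p \<circ> q" "\<one>\<^bsub>Aut X\<^esub> = id"
  "p \<in> carrier (Aut X) \<Longrightarrow> p permutes verts X"
  by (simp_all add: Aut_def perm_group_def)

section \<open>Recognising the isomorphism types\<close>

lemma (in group) int_pow_mod:
  assumes "x \<in> carrier G" "x [^] n = \<one>"
  shows "x [^] (k mod int n) = x [^] (k::int)"
proof -
  have "x [^] k = x [^] (int n * (k div int n) + k mod int n)" by simp
  also have "\<dots> = (x [^] int n) [^] (k div int n) \<otimes> x [^] (k mod int n)"
    unfolding int_pow_mult[OF assms(1)] int_pow_pow[OF assms(1)] ..
  also have "\<dots> = x [^] (k mod int n)"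
    using assms by (simp add: int_pow_int)
  finally show ?thesis by simp
qed

text \<open>
  By Lagrange \<open>x\<close> raised to the order of the group is the identity, so that \<open>k \<mapsto> x^k\<close> is a
  homomorphism on residues. It is onto because \<open>x\<close> generates, and injective by counting.
\<close>

lemma (in group) cyclic_iso_integer_mod_group:
  assumes x: "x \<in> carrier G" "carrier G = generate G {x}" and n: "order G = n" "n > 0"
  shows "G \<cong> integer_mod_group n"
proof -
  let ?f = "\<lambda>k::int. x [^] k"
  have one: "x [^] n = \<one>" using pow_order_eq_1[OF x(1)] n(1) by simp
  have hom: "?f \<in> hom (integer_mod_group n) G"
    using x(1) by (intro homI) (simp_all add: int_pow_mod[OF x(1) one] int_pow_mult)
  have "carrier G \<subseteq> ?f ` carrier (integer_mod_group n)"
  proof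
    fix y assume "y \<in> carrier G"
    then have "y \<in> generate G {x}" using x(2) by simp
    then obtain k :: int where "y = x [^] k" unfolding generate_pow[OF x(1)] by blast
    then have "y = ?f (k mod int n)" by (simp add: int_pow_mod[OF x(1) one])
    then show "y \<in> ?f ` carrier (integer_mod_group n)"
      using n(2) by (simp add: carrier_integer_mod_group)
  qed
  then have surj: "?f ` carrier (integer_mod_group n) = carrier G"
    using hom by (auto simp: hom_def)
  moreover have "card (carrier (integer_mod_group n)) = card (carrier G)"
    using n by (simp add: carrier_integer_mod_group order_def)
  ultimately have "inj_on ?f (carrier (integer_mod_group n))"
    using n(2) by (intro eq_card_imp_inj_on) (simp_all add: carrier_integer_mod_group)
  with hom surj have "?f \<in> iso (integer_mod_group n) G"
    by (simp add: iso_def bij_betw_def)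
  then show ?thesis
    by (intro group.iso_sym[OF group_integer_mod_group]) (auto simp: is_iso_def)
qed

text \<open>
  The product of two different involutions \<open>a\<close>, \<open>b\<close> is neither the identity nor \<open>a\<close> nor \<open>b\<close>. With
  only four elements this forces \<open>a b = b a\<close>, and the group is the direct product of the two
  subgroups of order 2.
\<close>

lemma (in group) order_4_iso_Klein:
  assumes ab: "a \<in> carrier G" "b \<in> carrier G" and sq: "a \<otimes> a = \<one>" "b \<otimes> b = \<one>"
    and ne: "a \<noteq> \<one>" "b \<noteq> \<one>" "a \<noteq> b" and ord: "order G = 4"
  shows "G \<cong> integer_mod_group 2 \<times>\<times> integer_mod_group 2"
proof -
  let ?Z = "integer_mod_group 2"
  have prod_ne: "x \<otimes> y \<notin> {\<one>, x, y}"
    if "x \<in> {a, b}" "y \<in> {a, b}" "x \<noteq> y" for x y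
  proof -
    have *: "x \<in> carrier G" "y \<in> carrier G" "x \<noteq> \<one>" "y \<noteq> \<one>" "x \<otimes> x = \<one>"
      using that ab ne sq by auto
    have "x \<otimes> y \<noteq> \<one>" using * that(3) Units_l_cancel[of x y x] by auto
    then show ?thesis using * l_cancel_one[of x y] r_cancel_one[of y x] by auto
  qed
  have fin: "finite (carrier G)" using ord by (intro card_ge_0_finite) (simp add: order_def)
  have "card {\<one>, a, b, a \<otimes> b} = 4" using ne prod_ne[of a b] by auto
  then have carrier: "carrier G = {\<one>, a, b, a \<otimes> b}"
    using ab ord by (intro card_subset_eq[OF fin, symmetric]) (auto simp: order_def)
  have "b \<otimes> a \<in> carrier G" using ab by simp
  then have comm: "b \<otimes> a = a \<otimes> b" using prod_ne[of b a] ne(3) unfolding carrier by auto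
  let ?A = "\<lambda>i::int. if i = 0 then \<one> else a" and ?B = "\<lambda>i::int. if i = 0 then \<one> else b"
  let ?f = "\<lambda>(i, j). ?A i \<otimes> ?B j"
  have Z: "carrier ?Z = {0, 1}" by (auto simp: carrier_integer_mod_group)
  have A: "?A i \<otimes> ?A k = ?A ((i + k) mod 2)" "?B i \<otimes> ?B k = ?B ((i + k) mod 2)"
    "?B i \<otimes> ?A k = ?A k \<otimes> ?B i"
    if "i \<in> {0, 1}" "k \<in> {0, 1}" for i k
    using that ab sq comm by auto
  have "?f \<in> hom (?Z \<times>\<times> ?Z) G"
  proof (rule homI)
    fix x y assume "x \<in> carrier (?Z \<times>\<times> ?Z)" "y \<in> carrier (?Z \<times>\<times> ?Z)"
    then obtain i j k l where xy: "x = (i, j)" "y = (k, l)"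
      and ijkl: "i \<in> {0, 1}" "j \<in> {0, 1}" "k \<in> {0, 1}" "l \<in> {0, 1}"
      by (auto simp: Z)
    have carr: "?A i \<in> carrier G" "?B i \<in> carrier G" for i using ab by auto
    have "?f (x \<otimes>\<^bsub>?Z \<times>\<times> ?Z\<^esub> y) = (?A i \<otimes> ?A k) \<otimes> (?B j \<otimes> ?B l)"
      unfolding A(1)[OF ijkl(1,3)] A(2)[OF ijkl(2,4)] xy by simp
    also have "\<dots> = ?A i \<otimes> (?A k \<otimes> ?B j) \<otimes> ?B l"
      using carr by (simp only: m_assoc m_closed)
    also have "\<dots> = ?A i \<otimes> (?B j \<otimes> ?A k) \<otimes> ?B l"
      unfolding A(3)[OF ijkl(2,3)] ..
    also have "\<dots> = (?A i \<otimes> ?B j) \<otimes> (?A k \<otimes> ?B l)"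
      using carr by (simp only: m_assoc m_closed)
    finally show "?f (x \<otimes>\<^bsub>?Z \<times>\<times> ?Z\<^esub> y) = ?f x \<otimes> ?f y" by (simp add: xy)
  qed (use ab in auto)
  moreover have surj: "?f ` carrier (?Z \<times>\<times> ?Z) = carrier G"
    unfolding carrier using ab by (force simp: Z)
  moreover have "inj_on ?f (carrier (?Z \<times>\<times> ?Z))"
  proof (rule eq_card_imp_inj_on)
    have "card (carrier (?Z \<times>\<times> ?Z)) = 4" by (simp add: Z)
    then show "card (?f ` carrier (?Z \<times>\<times> ?Z)) = card (carrier (?Z \<times>\<times> ?Z))"
      unfolding surj using ord by (simp add: order_def)
  qed (simp add: Z)
  ultimately have "?f \<in> iso (?Z \<times>\<times> ?Z) G" by (simp add: iso_def bij_betw_def)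
  then show ?thesis
    by (intro group.iso_sym[OF DirProd_group]) (auto simp: is_iso_def)
qed

text \<open>
  A system of blocks on the vertices, numbered \<open>1, \<dots>, m\<close>, that all automorphisms respect: the
  automorphisms act on the numbers of the blocks. The hypothesis \<open>blocks\<close> says that the block of
  an image is determined by the block of the vertex, through the representative \<open>rep\<close> of the latter.
\<close>

definition block_action :: "('v \<Rightarrow> nat) \<Rightarrow> (nat \<Rightarrow> 'v) \<Rightarrow> nat \<Rightarrow> ('v \<Rightarrow> 'v) \<Rightarrow> nat \<Rightarrow> nat" where
  "block_action block rep m p i = (if i \<in> {1..m} then block (p (rep i)) else i)"

lemma block_action_hom:
  assumes block: "\<And>v. v \<in> verts X \<Longrightarrow> block v \<in> {1..m}"
    and rep: "\<And>i. i \<in> {1..m} \<Longrightarrow> rep i \<in> verts X \<and> block (rep i) = i"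
    and blocks: "\<And>p v. p \<in> carrier (Aut X) \<Longrightarrow> v \<in> verts X \<Longrightarrow> block (p v) = block (p (rep (block v)))"
  shows "block_action block rep m \<in> hom (Aut X) (sym_group m)"
    (is "?\<phi> \<in> _")
proof (rule homI)
  interpret group "Aut X" by (rule group_Aut)
  have comp: "?\<phi> (p \<circ> q) = ?\<phi> p \<circ> ?\<phi> q"
    if pq: "p \<in> carrier (Aut X)" "q \<in> carrier (Aut X)" for p q
  proof
    fix i
    show "?\<phi> (p \<circ> q) i = (?\<phi> p \<circ> ?\<phi> q) i"
    proof (cases "i \<in> {1..m}")
      case True
      then have q: "q (rep i) \<in> verts X"
        using rep permutes_in_image[OF Aut_sel(3)[OF pq(2)]] by blast
      then have "block (q (rep i)) \<in> {1..m}" by (rule block)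
      then show ?thesis using True blocks[OF pq(1) q] by (simp add: block_action_def)
    qed (auto simp: block_action_def)
  qed
  have id: "?\<phi> id = id" using rep by (auto simp: block_action_def)
  show "?\<phi> p \<in> carrier (sym_group m)" if p: "p \<in> carrier (Aut X)" for p
  proof -
    let ?q = "inv\<^bsub>Aut X\<^esub> p"
    have q: "?q \<in> carrier (Aut X)" using p by simp
    have "?\<phi> p \<circ> ?\<phi> ?q = id" "?\<phi> ?q \<circ> ?\<phi> p = id"
      using comp[OF p q] comp[OF q p] r_inv[OF p] l_inv[OF p] id by (simp_all add: Aut_sel)
    then have "bij (?\<phi> p)" by (intro o_bij)
    then have "?\<phi> p permutes {1..m}"
      unfolding permutes_def bij_iff by (auto simp: block_action_def)
    then show ?thesis by (simp add: sym_group_carrier)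
  qed
  show "?\<phi> (p \<otimes>\<^bsub>Aut X\<^esub> q) = ?\<phi> p \<otimes>\<^bsub>sym_group m\<^esub> ?\<phi> q"
    if "p \<in> carrier (Aut X)" "q \<in> carrier (Aut X)" for p q
    unfolding Aut_sel sym_group_mult using comp[OF that] .
qed

section \<open>The three maps\<close>

text \<open>
  The order of the faces is the order in which the search treats them: first the triangle 0 3 4
  and the quadrilaterals around 0, each of which shares an edge with one that has been placed
  before, then the other triangles. In this order there are never more than 48 partial maps.
\<close>

definition KNO1_faces :: "nat list list" where
  "KNO1_faces = [[0,3,4], [0,1,2,3], [0,4,5,6], [0,6,7,8], [0,1,9,8],
      [1,9,10], [6,7,11], [2,5,8],
      [6,1,10,5], [1,6,11,2], [8,5,4,9], [8,2,3,7],
      [7,9,10,3], [9,7,11,4], [2,5,10,11], [4,3,10,11]]"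

definition KNO2_faces :: "nat list list" where
  "KNO2_faces = [[0,3,4], [0,1,2,3], [0,4,5,6], [0,6,7,8], [0,1,9,8],
      [6,7,11], [1,9,10], [2,5,8],
      [1,6,11,2], [6,1,10,5], [3,4,10,11], [11,10,5,2],
      [3,2,8,9], [3,9,7,11], [4,5,8,7], [4,7,9,10]]"

definition KO_faces :: "nat list list" where
  "KO_faces = [[0,3,4], [0,1,2,3], [0,4,5,6], [0,6,7,8], [0,1,9,8],
      [2,6,11], [1,5,9], [7,8,10],
      [1,7,6,2], [6,11,10,5], [3,4,11,9], [9,11,2,8],
      [3,2,8,10], [3,10,5,9], [4,5,1,7], [4,7,10,11]]"

lemma faces_maps:
  "faces KNO1 = polygon ` set KNO1_faces"
  "faces KNO2 = polygon ` set KNO2_faces"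
  "faces KO = polygon ` set KO_faces"
proof -
  show "faces KNO1 = polygon ` set KNO1_faces"
    unfolding KNO1_def KNO1_faces_def surface_map.simps by (intro arg_cong[of _ _ "(`) polygon"]) auto
  show "faces KNO2 = polygon ` set KNO2_faces"
    unfolding KNO2_def KNO2_faces_def surface_map.simps by (intro arg_cong[of _ _ "(`) polygon"]) auto
  show "faces KO = polygon ` set KO_faces"
    unfolding KO_def KO_faces_def surface_map.simps by (intro arg_cong[of _ _ "(`) polygon"]) auto
qed

lemma verts_maps:
  "verts KNO1 = {..<12}" "verts KNO2 = {..<12}" "verts KO = {..<12}"
  by (auto simp: KNO1_def KNO2_def KO_def)

lemma faces_bounded:
  "\<forall>f\<in>set KNO1_faces. f \<noteq> [] \<and> set f \<subseteq> {..<12}"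
  "\<forall>f\<in>set KNO2_faces. f \<noteq> [] \<and> set f \<subseteq> {..<12}"
  "\<forall>f\<in>set KO_faces. f \<noteq> [] \<and> set f \<subseteq> {..<12}"
  by (simp_all add: KNO1_faces_def KNO2_faces_def KO_faces_def)

lemma perm_of_cycles_permutes: "perm_of_cycles css permutes (\<Union>cs\<in>set css. set cs)"
proof (induction css)
  case (Cons cs css)
  have "cycle_of_list cs permutes (\<Union>cs\<in>set (cs # css). set cs)"
    by (rule permutes_subset[OF cycle_permutes]) simp
  moreover have "perm_of_cycles css permutes (\<Union>cs\<in>set (cs # css). set cs)"
    by (rule permutes_subset[OF Cons.IH]) simp
  ultimately have "cycle_of_list cs \<circ> perm_of_cycles css permutes (\<Union>cs\<in>set (cs # css). set cs)"
    by (rule permutes_compose[rotated])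
  then show ?case by (simp add: perm_of_cycles_def comp_def)
qed (simp add: perm_of_cycles_def id_def)

lemma perm_of_cycles_permutes_lessThan:
  "\<forall>cs\<in>set css. \<forall>x\<in>set cs. x < n \<Longrightarrow> perm_of_cycles css permutes {..<n}"
  by (rule permutes_subset[OF perm_of_cycles_permutes]) auto

lemma generators_permute:
  "\<forall>g\<in>set [\<alpha>\<^sub>1, \<alpha>\<^sub>2, \<beta>\<^sub>1, \<beta>\<^sub>2, \<beta>\<^sub>3, \<beta>\<^sub>4, \<gamma>]. g permutes {..<12}"
  by (simp add: \<alpha>\<^sub>1_def \<alpha>\<^sub>2_def \<beta>\<^sub>1_def \<beta>\<^sub>2_def \<beta>\<^sub>3_def \<beta>\<^sub>4_def \<gamma>_def perm_of_cycles_permutes_lessThan)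

definition KNO1_generator_rows :: "nat list list" where
  "KNO1_generator_rows =
    [[0,6,5,4,3,2,1,9,8,7,11,10], [8,7,3,2,5,4,9,1,0,6,11,10]]"

definition KNO2_generator_rows :: "nat list list" where
  "KNO2_generator_rows =
    [[0,6,5,4,3,2,1,9,8,7,11,10], [6,0,8,7,11,2,1,10,5,4,3,9],
    [8,7,4,5,2,3,9,1,0,6,11,10], [10,4,7,9,1,6,5,2,11,3,0,8]]"

definition KO_generator_rows :: "nat list list" where
  "KO_generator_rows =
    [[2,8,9,11,6,7,1,0,3,10,4,5]]"

lemma lessThan_12: "[0..<12] = [0,1,2,3,4,5,6,7,8,9,10,11::nat]"
  by code_simp

lemma row_KNO1_generators: "map (row 12) [\<alpha>\<^sub>1, \<alpha>\<^sub>2] = KNO1_generator_rows"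
  by (simp add: KNO1_generator_rows_def row_def lessThan_12 \<alpha>\<^sub>1_def \<alpha>\<^sub>2_def
      perm_of_cycles_def transpose_def)

lemma row_KNO2_generators: "map (row 12) [\<beta>\<^sub>1, \<beta>\<^sub>2, \<beta>\<^sub>3, \<beta>\<^sub>4] = KNO2_generator_rows"
  by (simp add: KNO2_generator_rows_def row_def lessThan_12 \<beta>\<^sub>1_def \<beta>\<^sub>2_def \<beta>\<^sub>3_def \<beta>\<^sub>4_def
      perm_of_cycles_def transpose_def)

lemma row_KO_generators: "map (row 12) [\<gamma>] = KO_generator_rows"
  by (simp add: KO_generator_rows_def row_def lessThan_12 \<gamma>_def
      perm_of_cycles_def transpose_def)

text \<open>
  The orders of the generators bound the exponents. In the second map the products of the powers
  of the four generators, in this order, are 2 * 3 * 2 * 2 = 24 different permutations.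
\<close>

definition KNO1_rows :: "nat list list" where
  "KNO1_rows = product_rows 12 (zip KNO1_generator_rows [2, 2])"

definition KNO2_rows :: "nat list list" where
  "KNO2_rows = product_rows 12 (zip KNO2_generator_rows [2, 3, 2, 2])"

definition KO_rows :: "nat list list" where
  "KO_rows = product_rows 12 (zip KO_generator_rows [12])"

lemma KNO1_generators_preserve_faces:
  "\<forall>r\<in>set KNO1_generator_rows. \<forall>f\<in>set KNO1_faces.
     compose_rows r f \<in> set (corner_table 12 (boundary_words KNO1_faces) ! hd (compose_rows r f))"
  by code_simp

lemma KNO1_search:
  "set (search (corner_table 12 (boundary_words KNO1_faces)) KNO1_faces [replicate 12 None])
     \<subseteq> set (map (map Some) KNO1_rows)"
  by code_simp

lemma KNO2_generators_preserve_faces: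
  "\<forall>r\<in>set KNO2_generator_rows. \<forall>f\<in>set KNO2_faces.
     compose_rows r f \<in> set (corner_table 12 (boundary_words KNO2_faces) ! hd (compose_rows r f))"
  by code_simp

lemma KNO2_search:
  "set (search (corner_table 12 (boundary_words KNO2_faces)) KNO2_faces [replicate 12 None])
     \<subseteq> set (map (map Some) KNO2_rows)"
  by code_simp

lemma KO_generators_preserve_faces:
  "\<forall>r\<in>set KO_generator_rows. \<forall>f\<in>set KO_faces.
     compose_rows r f \<in> set (corner_table 12 (boundary_words KO_faces) ! hd (compose_rows r f))"
  by code_simp

lemma KO_search:
  "set (search (corner_table 12 (boundary_words KO_faces)) KO_faces [replicate 12 None])
     \<subseteq> set (map (map Some) KO_rows)"
  by code_simp

lemma Aut_KNO1:
  "carrier (Aut KNO1) = generate (perm_group {..<12}) (set [\<alpha>\<^sub>1, \<alpha>\<^sub>2])"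
  "row 12 ` carrier (Aut KNO1) = set KNO1_rows"
  unfolding KNO1_rows_def
  by (rule Aut_by_search[OF verts_maps(1) faces_maps(1) faces_bounded(1) _ row_KNO1_generators
        KNO1_generators_preserve_faces KNO1_search[unfolded KNO1_rows_def]];
      use generators_permute in simp)+

lemma Aut_KNO2:
  "carrier (Aut KNO2) = generate (perm_group {..<12}) (set [\<beta>\<^sub>1, \<beta>\<^sub>2, \<beta>\<^sub>3, \<beta>\<^sub>4])"
  "row 12 ` carrier (Aut KNO2) = set KNO2_rows"
  unfolding KNO2_rows_def
  by (rule Aut_by_search[OF verts_maps(2) faces_maps(2) faces_bounded(2) _ row_KNO2_generators
        KNO2_generators_preserve_faces KNO2_search[unfolded KNO2_rows_def]];
      use generators_permute in simp)+

lemma Aut_KO: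
  "carrier (Aut KO) = generate (perm_group {..<12}) (set [\<gamma>])"
  "row 12 ` carrier (Aut KO) = set KO_rows"
  unfolding KO_rows_def
  by (rule Aut_by_search[OF verts_maps(3) faces_maps(3) faces_bounded(3) _ row_KO_generators
        KO_generators_preserve_faces KO_search[unfolded KO_rows_def]];
      use generators_permute in simp)+

section \<open>The isomorphism types of the three groups\<close>

lemma KO_iso: "Aut KO \<cong> integer_mod_group 12"
proof -
  have "distinct KO_rows" "length KO_rows = 12" by code_simp+
  then have order: "order (Aut KO) = 12"
    using order_Aut[OF verts_maps(3) Aut_KO(2)] by simp
  have \<gamma>: "\<gamma> \<in> carrier (Aut KO)" unfolding Aut_KO(1) by (simp add: generate.incl)
  then have "carrier (Aut KO) = generate (Aut KO) {\<gamma>}"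
    using generate_Aut[of "{\<gamma>}" KO] Aut_KO(1) by (simp add: verts_maps)
  with \<gamma> order show ?thesis
    by (intro group.cyclic_iso_integer_mod_group[OF group_Aut]) simp_all
qed

lemma comp_self_eq_id:
  assumes p: "p permutes {..<n}" and sq: "compose_rows (row n p) (row n p) = [0..<n]"
  shows "p \<circ> p = id"
proof -
  have "p i < n" if "i < n" for i using permutes_in_image[OF p, of i] that by simp
  then have "set (row n p) \<subseteq> {..<n}" unfolding row_def by auto
  then have "map p (row n p) = [0..<n]" using sq compose_rows_map by metis
  then have "row n (p \<circ> p) = row n id" by (simp add: row_def)
  moreover have "p \<circ> p permutes {..<n}" "id permutes {..<n}"
    using permutes_compose[OF p p] permutes_id by blast+
  ultimately show ?thesis using inj_onD[OF inj_on_row] by blast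
qed

lemma KNO1_iso: "Aut KNO1 \<cong> integer_mod_group 2 \<times>\<times> integer_mod_group 2"
proof -
  have "distinct KNO1_rows" "length KNO1_rows = 4" by code_simp+
  then have order: "order (Aut KNO1) = 4"
    using order_Aut[OF verts_maps(1) Aut_KNO1(2)] by simp
  have mem: "\<alpha>\<^sub>1 \<in> carrier (Aut KNO1)" "\<alpha>\<^sub>2 \<in> carrier (Aut KNO1)"
    unfolding Aut_KNO1(1) by (simp_all add: generate.incl)
  have rows: "row 12 \<alpha>\<^sub>1 = [0,6,5,4,3,2,1,9,8,7,11,10]" "row 12 \<alpha>\<^sub>2 = [8,7,3,2,5,4,9,1,0,6,11,10]"
    using row_KNO1_generators by (simp_all add: KNO1_generator_rows_def)
  have sq: "\<alpha>\<^sub>1 \<circ> \<alpha>\<^sub>1 = id" "\<alpha>\<^sub>2 \<circ> \<alpha>\<^sub>2 = id"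
    by (rule comp_self_eq_id[where n = 12];
        use generators_permute in \<open>simp add: rows compose_rows_def lessThan_12\<close>)+
  have "row 12 id = [0,1,2,3,4,5,6,7,8,9,10,11]" by (simp add: row_def lessThan_12)
  then have "row 12 \<alpha>\<^sub>1 \<noteq> row 12 id" "row 12 \<alpha>\<^sub>2 \<noteq> row 12 id" "row 12 \<alpha>\<^sub>1 \<noteq> row 12 \<alpha>\<^sub>2"
    by (simp_all add: rows)
  then have ne: "\<alpha>\<^sub>1 \<noteq> id" "\<alpha>\<^sub>2 \<noteq> id" "\<alpha>\<^sub>1 \<noteq> \<alpha>\<^sub>2" by metis+
  show ?thesis
    by (rule group.order_4_iso_Klein[OF group_Aut mem]) (simp_all add: Aut_sel sq ne order)
qed

text \<open>
  The triangles of the second map are numbered 1, \<open>\<dots>\<close>, 4; \<open>KNO2_rep\<close> selects a vertex of each (its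
  value at 0 is arbitrary).
\<close>

definition KNO2_block :: "nat \<Rightarrow> nat" where
  "KNO2_block v = [1,3,4,1,1,4,2,2,4,3,3,2] ! v"

definition KNO2_rep :: "nat \<Rightarrow> nat" where
  "KNO2_rep i = [0,0,6,1,2] ! i"

lemma KNO2_rep:
  assumes "i \<in> {1..4}"
  shows "KNO2_rep i < 12 \<and> KNO2_block (KNO2_rep i) = i"
proof -
  have "i = 1 \<or> i = 2 \<or> i = 3 \<or> i = 4" using assms by auto
  then show ?thesis by (elim disjE) (simp_all add: KNO2_rep_def KNO2_block_def)
qed

lemma KNO2_block:
  assumes "v < 12"
  shows "KNO2_block v \<in> {1..4}"
    and "\<exists>f\<in>set KNO2_faces. length f = 3 \<and> v \<in> set f \<and> KNO2_rep (KNO2_block v) \<in> set f"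
proof -
  have "v \<in> set [0..<12]" using assms by simp
  then have v: "v = 0 \<or> v = 1 \<or> v = 2 \<or> v = 3 \<or> v = 4 \<or> v = 5 \<or>
      v = 6 \<or> v = 7 \<or> v = 8 \<or> v = 9 \<or> v = 10 \<or> v = 11"
    unfolding lessThan_12 by simp
  then show "KNO2_block v \<in> {1..4}"
    by (elim disjE) (simp_all add: KNO2_block_def)
  have "\<exists>f\<in>set [[0,3,4], [6,7,11], [1,9,10], [2,5,8]].
      v \<in> set f \<and> KNO2_rep (KNO2_block v) \<in> set f"
    using v by (elim disjE) (simp_all add: KNO2_block_def KNO2_rep_def)
  then show "\<exists>f\<in>set KNO2_faces. length f = 3 \<and> v \<in> set f \<and> KNO2_rep (KNO2_block v) \<in> set f"
    by (auto simp: KNO2_faces_def)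
qed

fun KNO2_one_block :: "nat list \<Rightarrow> bool" where
  "KNO2_one_block [x, y, z] \<longleftrightarrow> KNO2_block x = KNO2_block y \<and> KNO2_block y = KNO2_block z"
| "KNO2_one_block _ \<longleftrightarrow> True"

lemma KNO2_triangles_are_blocks:
  "\<forall>w\<in>set (boundary_words KNO2_faces). KNO2_one_block w"
  by code_simp

text \<open>
  The vertices 0, 6, 1, 2 represent the triangles 1, 2, 3, 4; the blocks of their images tell how
  the triangles are permuted.
\<close>

definition KNO2_block_row :: "nat list \<Rightarrow> nat list" where
  "KNO2_block_row r = map KNO2_block (map ((!) r) [0,6,1,2])"

lemma KNO2_rows_faithful: "distinct (map KNO2_block_row KNO2_rows)"
  by code_simp

text \<open>
  The action on the triangles is injective because the 24 rows act differently, and it is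
  surjective because the symmetric group has no more than 24 elements.
\<close>

lemma KNO2_iso: "Aut KNO2 \<cong> sym_group 4"
proof -
  let ?C = "carrier (Aut KNO2)" and ?\<phi> = "block_action KNO2_block KNO2_rep 4"
  have "distinct KNO2_rows" and inj: "inj_on KNO2_block_row (set KNO2_rows)"
    using KNO2_rows_faithful by (simp_all only: distinct_map)
  moreover have "length KNO2_rows = 24" by code_simp
  ultimately have card: "card ?C = 24"
    using order_Aut[OF verts_maps(2) Aut_KNO2(2)] by (simp add: order_def)
  have hom: "?\<phi> \<in> hom (Aut KNO2) (sym_group 4)"
  proof (rule block_action_hom)
    fix p v assume p: "p \<in> ?C" and "v \<in> verts KNO2"
    then obtain f where f: "f \<in> set KNO2_faces" "length f = 3" "v \<in> set f"
      "KNO2_rep (KNO2_block v) \<in> set f"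
      using KNO2_block(2)[of v] by (auto simp: verts_maps)
    have "[] \<notin> set KNO2_faces" using faces_bounded(2) by blast
    then have "map p f \<in> set (boundary_words KNO2_faces)"
      using p f(1) carrier_Aut_iff[OF faces_maps(2)] by blast
    then have "KNO2_one_block (map p f)" using KNO2_triangles_are_blocks by blast
    moreover obtain x y z where "map p f = [x, y, z]"
      using f(2) by (auto simp: numeral_3_eq_3 length_Suc_conv)
    moreover have "p v \<in> set (map p f)" "p (KNO2_rep (KNO2_block v)) \<in> set (map p f)"
      using f(3,4) by simp_all
    ultimately show "KNO2_block (p v) = KNO2_block (p (KNO2_rep (KNO2_block v)))"
      by auto
  qed (use KNO2_block(1) KNO2_rep in \<open>simp_all add: verts_maps\<close>)
  have "inj_on ?\<phi> ?C"
  proof (rule inj_onI)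
    fix p q assume pq: "p \<in> ?C" "q \<in> ?C" "?\<phi> p = ?\<phi> q"
    have block_row: "KNO2_block_row (row 12 g) = map (?\<phi> g) [1,2,3,4]" for g
      by (simp add: KNO2_block_row_def block_action_def KNO2_rep_def row_def lessThan_12)
    have "row 12 p = row 12 q"
    proof (rule inj_onD[OF inj])
      show "KNO2_block_row (row 12 p) = KNO2_block_row (row 12 q)" unfolding block_row pq(3) ..
    qed (use pq Aut_KNO2(2) in blast)+
    then show "p = q"
      using inj_onD[OF inj_on_row] Aut_sel(3)[OF pq(1)] Aut_sel(3)[OF pq(2)]
      by (simp add: verts_maps)
  qed
  moreover have "?\<phi> ` ?C = carrier (sym_group 4)"
  proof (rule card_subset_eq)
    show "?\<phi> ` ?C \<subseteq> carrier (sym_group 4)" using hom by (auto simp: hom_def)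
    show "card (?\<phi> ` ?C) = card (carrier (sym_group 4))"
      using card_image[OF \<open>inj_on ?\<phi> ?C\<close>] card
      by (simp add: sym_group_card_carrier fact_numeral)
    show "finite (carrier (sym_group 4))"
      by (intro card_ge_0_finite) (simp add: sym_group_card_carrier)
  qed
  ultimately have "?\<phi> \<in> iso (Aut KNO2) (sym_group 4)" using hom by (simp add: iso_def bij_betw_def)
  then show ?thesis by (auto simp: is_iso_def)
qed

theorem lemma1:
  shows "carrier (Aut KNO1) = generate (perm_group {0..11}) {\<alpha>\<^sub>1, \<alpha>\<^sub>2}
           \<and> Aut KNO1 \<cong> integer_mod_group 2 \<times>\<times> integer_mod_group 2
       \<and> carrier (Aut KNO2) = generate (perm_group {0..11}) {\<beta>\<^sub>1, \<beta>\<^sub>2, \<beta>\<^sub>3, \<beta>\<^sub>4}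
           \<and> Aut KNO2 \<cong> sym_group 4
       \<and> carrier (Aut KO) = generate (perm_group {0..11}) {\<gamma>}
           \<and> Aut KO \<cong> integer_mod_group 12"
proof -
  have "{0..11} = {..<12::nat}" by auto
  then show ?thesis
    using Aut_KNO1(1) Aut_KNO2(1) Aut_KO(1) KNO1_iso KNO2_iso KO_iso by simp
qed

end
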